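(* Let $0\longrightarrow B\stackrel{i}{\longrightarrow}E\stackrel{p}{\longrightarrow}A\longrightarrow0$ be a non-abelian extension of an anti-dendriform algebra $(A,\succ_A,\prec_A)$ by $(B,\succ_B,\prec_B)$ with a section $s$ of $p$ and let $(l_{\succ},r_{\succ},l_{\prec},r_{\prec},\omega_1,\omega_2)$ be the corresponding non-abelian 2-cocycle induced by $s$. A pair $(\alpha,\beta)\in\mathrm{Aut}(A)\times\mathrm{Aut}(B)$ is inducible if and only if $(l_{\succ},r_{\succ},l_{\prec},r_{\prec},\omega_1,\omega_2)$ and $(l_{(\succ,\alpha,\beta)},r_{(\succ,\alpha,\beta)},l_{(\prec,\alpha,\beta)},r_{(\prec,\alpha,\beta)},\omega_{(1,\alpha,\beta)},\omega_{(2,\alpha,\beta)})$ are equivalent (i.e. cohomologous) non-abelian 2-cocycles.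
   Context: All vector spaces and algebras are over a field $k$, and all algebras are finite-dimensional. An anti-dendriform algebra $(A,\succ,\prec)$ is a vector space with two bilinear maps $\succ,\prec:A\times A\to A$ such that, writing $x\cdot y=x\succ y+x\prec y$, for all $x,y,z$: $x\succ(y\succ z)=-(x\cdot y)\succ z=-x\prec(y\cdot z)=(x\prec y)\prec z$ and $(x\succ y)\prec z=x\succ(y\prec z)$. Homomorphisms preserve both operations; $\mathrm{Aut}$ denotes the group of automorphisms. A non-abelian extension of $A$ by $B$ is an anti-dendriform algebra $(E,\succ_E,\prec_E)$ with a short exact sequence $0\to B\stackrel{i}{\to}E\stackrel{p}{\to}A\to0$ of anti-dendriform algebras; $B$ is identified with $i(B)$. A section of $p$ is a linear map $s:A\to E$ with $ps=\mathrm{id}_A$. A non-abelian 2-cocycle of $A$ with values in $B$ is a tuple $(l_{\succ},r_{\succ},l_{\prec},r_{\prec},\omega_1,\omega_2)$ of linear maps $l_{\succ},r_{\succ},l_{\prec},r_{\prec}:A\to\mathrm{End}(B)$ and bilinear maps $\omega_1,\omega_2:A\times A\to B$ such that $A\oplus B$ with $(x,a)\succeq(y,b)=(x\succ_A y,\omega_1(x,y)+l_{\succ}(x)b+r_{\succ}(y)a+a\succ_B b)$ and $(x,a)\preceq(y,b)=(x\prec_A y,\omega_2(x,y)+l_{\prec}(x)b+r_{\prec}(y)a+a\prec_B b)$ is an anti-dendriform algebra. Two non-abelian 2-cocycles (the second with primes) are cohomologous if there is a linear map $\zeta:A\to B$ with, for all $x,y\in A$, $a\in B$: $l_{\prec}(x)a=l'_{\prec}(x)a+\zeta(x)\prec_B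 a$, $l_{\succ}(x)a=l'_{\succ}(x)a+\zeta(x)\succ_B a$, $r_{\prec}(x)a=r'_{\prec}(x)a+a\prec_B\zeta(x)$, $r_{\succ}(x)a=r'_{\succ}(x)a+a\succ_B\zeta(x)$, $\omega_1(x,y)+\zeta(x\succ_A y)=\omega'_1(x,y)+l'_{\succ}(x)\zeta(y)+r'_{\succ}(y)\zeta(x)+\zeta(x)\succ_B\zeta(y)$, $\omega_2(x,y)+\zeta(x\prec_A y)=\omega'_2(x,y)+l'_{\prec}(x)\zeta(y)+r'_{\prec}(y)\zeta(x)+\zeta(x)\prec_B\zeta(y)$. The non-abelian 2-cocycle induced by $s$ is: $l_{\succ}(x)a=s(x)\succ_E a$, $r_{\succ}(x)a=a\succ_E s(x)$, $l_{\prec}(x)a=s(x)\prec_E a$, $r_{\prec}(x)a=a\prec_E s(x)$, $\omega_1(x,y)=s(x)\succ_E s(y)-s(x\succ_A y)$, $\omega_2(x,y)=s(x)\prec_E s(y)-s(x\prec_A y)$. For $(\alpha,\beta)\in\mathrm{Aut}(A)\times\mathrm{Aut}(B)$ define $l_{(\succ,\alpha,\beta)}(x)a=\beta(l_{\succ}(\alpha^{-1}(x))\beta^{-1}(a))$, $r_{(\succ,\alpha,\beta)}(x)a=\beta(r_{\succ}(\alpha^{-1}(x))\beta^{-1}(a))$, $l_{(\prec,\alpha,\beta)}(x)a=\beta(l_{\prec}(\alpha^{-1}(x))\beta^{-1}(a))$, $r_{(\prec,\alpha,\beta)}(x)a=\beta(r_{\prec}(\alpha^{-1}(x))\beta^{-1}(a))$,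 $\omega_{(j,\alpha,\beta)}(x,y)=\beta\omega_j(\alpha^{-1}(x),\alpha^{-1}(y))$ for $j=1,2$; this is again a non-abelian 2-cocycle. $(\alpha,\beta)$ is inducible if there is $\gamma\in\mathrm{Aut}(E)$ with $\gamma(B)=B$, $i\beta=\gamma i$ and $p\gamma=\alpha p$. *)

theory Defs
  imports "HOL-Analysis.Product_Vector"
begin

text \<open>The carrier of an algebra is the whole type \<open>'a\<close>; the field \<open>'k\<close> acts on it through \<open>smult\<close>.\<close>

record ('k, 'a) ad_alg =
  smult :: "'k \<Rightarrow> 'a \<Rightarrow> 'a"
  ad_succ :: "'a \<Rightarrow> 'a \<Rightarrow> 'a" (infixl "\<succ>\<index>" 70)
  ad_prec :: "'a \<Rightarrow> 'a \<Rightarrow> 'a" (infixl "\<prec>\<index>" 70)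

abbreviation lin :: "('k::field, 'a::ab_group_add) ad_alg \<Rightarrow> ('k, 'b::ab_group_add) ad_alg
    \<Rightarrow> ('a \<Rightarrow> 'b) \<Rightarrow> bool" where
  "lin A B \<equiv> Vector_Spaces.linear (smult A) (smult B)"

definition bilin :: "('k::field, 'a::ab_group_add) ad_alg \<Rightarrow> ('k, 'b::ab_group_add) ad_alg
    \<Rightarrow> ('k, 'c::ab_group_add) ad_alg \<Rightarrow> ('a \<Rightarrow> 'b \<Rightarrow> 'c) \<Rightarrow> bool" where
  "bilin A B C f \<longleftrightarrow> (\<forall>x. lin B C (f x)) \<and> (\<forall>y. lin A C (\<lambda>x. f x y))"

definition ad_dot :: "('k, 'a::ab_group_add) ad_alg \<Rightarrow> 'a \<Rightarrow> 'a \<Rightarrow> 'a" (infixl "\<cdot>\<index>" 70) where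
  "x \<cdot>\<^bsub>A\<^esub> y = x \<succ>\<^bsub>A\<^esub> y + x \<prec>\<^bsub>A\<^esub> y"

definition anti_dendriform :: "('k::field, 'a::ab_group_add) ad_alg \<Rightarrow> bool" where
  "anti_dendriform A \<longleftrightarrow>
    (\<exists>Basis. finite_dimensional_vector_space (smult A) Basis) \<and>
    bilin A A A (ad_succ A) \<and> bilin A A A (ad_prec A) \<and>
    (\<forall>x y z.
      x \<succ>\<^bsub>A\<^esub> (y \<succ>\<^bsub>A\<^esub> z) = - ((x \<cdot>\<^bsub>A\<^esub> y) \<succ>\<^bsub>A\<^esub> z) \<and>
      - ((x \<cdot>\<^bsub>A\<^esub> y) \<succ>\<^bsub>A\<^esub> z) = - (x \<prec>\<^bsub>A\<^esub> (y \<cdot>\<^bsub>A\<^esub> z)) \<and>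
      - (x \<prec>\<^bsub>A\<^esub> (y \<cdot>\<^bsub>A\<^esub> z)) = (x \<prec>\<^bsub>A\<^esub> y) \<prec>\<^bsub>A\<^esub> z \<and>
      (x \<succ>\<^bsub>A\<^esub> y) \<prec>\<^bsub>A\<^esub> z = x \<succ>\<^bsub>A\<^esub> (y \<prec>\<^bsub>A\<^esub> z))"

definition ad_hom :: "('k::field, 'a::ab_group_add) ad_alg \<Rightarrow> ('k, 'b::ab_group_add) ad_alg
    \<Rightarrow> ('a \<Rightarrow> 'b) set" where
  "ad_hom A B = {f. lin A B f \<and>
    (\<forall>x y. f (x \<succ>\<^bsub>A\<^esub> y) = f x \<succ>\<^bsub>B\<^esub> f y) \<and>
    (\<forall>x y. f (x \<prec>\<^bsub>A\<^esub> y) = f x \<prec>\<^bsub>B\<^esub> f y)}"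

definition ad_Aut :: "('k::field, 'a::ab_group_add) ad_alg \<Rightarrow> ('a \<Rightarrow> 'a) set" where
  "ad_Aut A = {f \<in> ad_hom A A. bij f}"

definition extension :: "('k::field, 'a::ab_group_add) ad_alg \<Rightarrow> ('k, 'b::ab_group_add) ad_alg
    \<Rightarrow> ('k, 'e::ab_group_add) ad_alg \<Rightarrow> ('b \<Rightarrow> 'e) \<Rightarrow> ('e \<Rightarrow> 'a) \<Rightarrow> bool" where
  "extension A B E i p \<longleftrightarrow>
    anti_dendriform A \<and> anti_dendriform B \<and> anti_dendriform E \<and>
    i \<in> ad_hom B E \<and> p \<in> ad_hom E A \<and>
    inj i \<and> range i = {e. p e = 0} \<and> surj p"

definition is_section :: "('k::field, 'a::ab_group_add) ad_alg \<Rightarrow> ('k, 'e::ab_group_add) ad_alg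
    \<Rightarrow> ('e \<Rightarrow> 'a) \<Rightarrow> ('a \<Rightarrow> 'e) \<Rightarrow> bool" where
  "is_section A E p s \<longleftrightarrow> lin A E s \<and> p \<circ> s = id"

record ('a, 'b) cochain =
  l_succ :: "'a \<Rightarrow> 'b \<Rightarrow> 'b"
  r_succ :: "'a \<Rightarrow> 'b \<Rightarrow> 'b"
  l_prec :: "'a \<Rightarrow> 'b \<Rightarrow> 'b"
  r_prec :: "'a \<Rightarrow> 'b \<Rightarrow> 'b"
  omega1 :: "'a \<Rightarrow> 'a \<Rightarrow> 'b"
  omega2 :: "'a \<Rightarrow> 'a \<Rightarrow> 'b"

definition sum_alg :: "('k::field, 'a::ab_group_add) ad_alg \<Rightarrow> ('k, 'b::ab_group_add) ad_alg
    \<Rightarrow> ('a, 'b) cochain \<Rightarrow> ('k, 'a \<times> 'b) ad_alg" where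
  "sum_alg A B c = \<lparr>
    smult = module_prod.scale (smult A) (smult B),
    ad_succ = (\<lambda>(x, a) (y, b).
      (x \<succ>\<^bsub>A\<^esub> y, omega1 c x y + l_succ c x b + r_succ c y a + a \<succ>\<^bsub>B\<^esub> b)),
    ad_prec = (\<lambda>(x, a) (y, b).
      (x \<prec>\<^bsub>A\<^esub> y, omega2 c x y + l_prec c x b + r_prec c y a + a \<prec>\<^bsub>B\<^esub> b))\<rparr>"

text \<open>A linear map from \<open>A\<close> to \<open>End(B)\<close> is given in curried form, as a bilinear map
  from \<open>A \<times> B\<close> to \<open>B\<close>.\<close>

definition cocycle :: "('k::field, 'a::ab_group_add) ad_alg \<Rightarrow> ('k, 'b::ab_group_add) ad_alg
    \<Rightarrow> ('a, 'b) cochain \<Rightarrow> bool" where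
  "cocycle A B c \<longleftrightarrow>
    bilin A B B (l_succ c) \<and> bilin A B B (r_succ c) \<and>
    bilin A B B (l_prec c) \<and> bilin A B B (r_prec c) \<and>
    bilin A A B (omega1 c) \<and> bilin A A B (omega2 c) \<and>
    anti_dendriform (sum_alg A B c)"

definition cohomologous :: "('k::field, 'a::ab_group_add) ad_alg
    \<Rightarrow> ('k, 'b::ab_group_add) ad_alg \<Rightarrow> ('a, 'b) cochain \<Rightarrow> ('a, 'b) cochain \<Rightarrow> bool" where
  "cohomologous A B c c' \<longleftrightarrow> cocycle A B c \<and> cocycle A B c' \<and>
    (\<exists>\<zeta>. lin A B \<zeta> \<and>
      (\<forall>x a. l_prec c x a = l_prec c' x a + \<zeta> x \<prec>\<^bsub>B\<^esub> a) \<and>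
      (\<forall>x a. l_succ c x a = l_succ c' x a + \<zeta> x \<succ>\<^bsub>B\<^esub> a) \<and>
      (\<forall>x a. r_prec c x a = r_prec c' x a + a \<prec>\<^bsub>B\<^esub> \<zeta> x) \<and>
      (\<forall>x a. r_succ c x a = r_succ c' x a + a \<succ>\<^bsub>B\<^esub> \<zeta> x) \<and>
      (\<forall>x y. omega1 c x y + \<zeta> (x \<succ>\<^bsub>A\<^esub> y) =
        omega1 c' x y + l_succ c' x (\<zeta> y) + r_succ c' y (\<zeta> x) + \<zeta> x \<succ>\<^bsub>B\<^esub> \<zeta> y) \<and>
      (\<forall>x y. omega2 c x y + \<zeta> (x \<prec>\<^bsub>A\<^esub> y) =
        omega2 c' x y + l_prec c' x (\<zeta> y) + r_prec c' y (\<zeta> x) + \<zeta> x \<prec>\<^bsub>B\<^esub> \<zeta> y))"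

text \<open>
  All values below lie in the ideal \<open>i(B)\<close> of \<open>E\<close>; \<open>inv i\<close> carries them
  back to \<open>B\<close> and so makes the identification of \<open>B\<close> with \<open>i(B)\<close> explicit.
\<close>

definition induced_cocycle :: "('k::field, 'a::ab_group_add) ad_alg
    \<Rightarrow> ('k, 'e::ab_group_add) ad_alg \<Rightarrow> ('b::ab_group_add \<Rightarrow> 'e) \<Rightarrow> ('a \<Rightarrow> 'e)
    \<Rightarrow> ('a, 'b) cochain" where
  "induced_cocycle A E i s = \<lparr>
    l_succ = (\<lambda>x a. inv i (s x \<succ>\<^bsub>E\<^esub> i a)),
    r_succ = (\<lambda>x a. inv i (i a \<succ>\<^bsub>E\<^esub> s x)),
    l_prec = (\<lambda>x a. inv i (s x \<prec>\<^bsub>E\<^esub> i a)),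
    r_prec = (\<lambda>x a. inv i (i a \<prec>\<^bsub>E\<^esub> s x)),
    omega1 = (\<lambda>x y. inv i (s x \<succ>\<^bsub>E\<^esub> s y - s (x \<succ>\<^bsub>A\<^esub> y))),
    omega2 = (\<lambda>x y. inv i (s x \<prec>\<^bsub>E\<^esub> s y - s (x \<prec>\<^bsub>A\<^esub> y)))\<rparr>"

definition twist :: "('a \<Rightarrow> 'a) \<Rightarrow> ('b \<Rightarrow> 'b) \<Rightarrow> ('a, 'b) cochain \<Rightarrow> ('a, 'b) cochain" where
  "twist \<alpha> \<beta> c = \<lparr>
    l_succ = (\<lambda>x a. \<beta> (l_succ c (inv \<alpha> x) (inv \<beta> a))),
    r_succ = (\<lambda>x a. \<beta> (r_succ c (inv \<alpha> x) (inv \<beta> a))),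
    l_prec = (\<lambda>x a. \<beta> (l_prec c (inv \<alpha> x) (inv \<beta> a))),
    r_prec = (\<lambda>x a. \<beta> (r_prec c (inv \<alpha> x) (inv \<beta> a))),
    omega1 = (\<lambda>x y. \<beta> (omega1 c (inv \<alpha> x) (inv \<alpha> y))),
    omega2 = (\<lambda>x y. \<beta> (omega2 c (inv \<alpha> x) (inv \<alpha> y)))\<rparr>"

definition inducible :: "('k::field, 'e::ab_group_add) ad_alg \<Rightarrow> ('b \<Rightarrow> 'e) \<Rightarrow> ('e \<Rightarrow> 'a)
    \<Rightarrow> ('a \<Rightarrow> 'a) \<Rightarrow> ('b \<Rightarrow> 'b) \<Rightarrow> bool" where
  "inducible E i p \<alpha> \<beta> \<longleftrightarrow>
    (\<exists>\<gamma> \<in> ad_Aut E. \<gamma> ` range i = range i \<and> i \<circ> \<beta> = \<gamma> \<circ> i \<and> p \<circ> \<gamma> = \<alpha> \<circ> p)"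

end

theory Submission
  imports Defs
begin

text \<open>
  The pair \<open>(\<alpha>, \<beta>)\<close> turns the extension \<open>(E, i, p)\<close> with section \<open>s\<close> into a second extension of
  \<open>A\<close> by \<open>B\<close> with the same middle term, namely \<open>(E, i \<circ> inv \<beta>, \<alpha> \<circ> p)\<close> with section
  \<open>s \<circ> inv \<alpha>\<close>. The cocycle that this section induces is exactly the twist of the original one
  (\<open>twist_induced_cocycle\<close>), and an automorphism \<open>\<gamma>\<close> of \<open>E\<close> witnesses inducibility iff it is an
  equivalence from the second extension to the first (\<open>inducible_iff_equivalent\<close>). The theorem is
  therefore an instance of the classification of extensions by cohomology classes
  (\<open>cohomologous_iff_equivalent_extensions\<close>): two extensions of \<open>A\<close> by \<open>B\<close> are equivalent iff
  their cocycles, for any choice of sections, are cohomologous.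

  For the classification, a section gives an isomorphism \<open>\<Phi> (x, a) = s x + i a\<close> from the algebra
  \<open>A \<oplus> B\<close> built from the induced cocycle onto \<open>E\<close>. This is also why the induced cocycle is a
  cocycle, for the anti-dendriform identities pull back along \<open>\<Phi>\<close>. Read through these isomorphisms,
  a linear map that is compatible with the inclusions of \<open>B\<close> and the projections to \<open>A\<close> is a shear
  \<open>(x, a) \<mapsto> (x, a - \<zeta> x)\<close> for a unique linear \<open>\<zeta>\<close>, and the equations that make two cocycles
  cohomologous via \<open>\<zeta>\<close> are, coefficient by coefficient, the statement that this shear is
  multiplicative (\<open>cohomologous_iff_shear_hom\<close>).
\<close>


section \<open>Linear and bilinear maps\<close>

lemma lin_iff:
  "lin X Y f \<longleftrightarrow> vector_space (smult X) \<and> vector_space (smult Y) \<and>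
    (\<forall>x y. f (x + y) = f x + f y) \<and> (\<forall>k x. f (smult X k x) = smult Y k (f x))"
  by (rule Vector_Spaces.linear_iff)

lemma lin_arith:
  assumes "lin X Y f"
  shows "f (x + y) = f x + f y" and "f (x - y) = f x - f y" and "f (- x) = - f x" and "f 0 = 0"
proof -
  interpret Vector_Spaces.linear "smult X" "smult Y" f by (fact assms)
  show "f (x + y) = f x + f y" "f (x - y) = f x - f y" "f (- x) = - f x" "f 0 = 0"
    by (simp_all add: add diff neg zero)
qed

lemma bilin_iff:
  "bilin X Y Z f \<longleftrightarrow>
    vector_space (smult X) \<and> vector_space (smult Y) \<and> vector_space (smult Z) \<and>
    (\<forall>x x' y. f (x + x') y = f x y + f x' y) \<and> (\<forall>x y y'. f x (y + y') = f x y + f x y') \<and>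
    (\<forall>k x y. f (smult X k x) y = smult Z k (f x y)) \<and>
    (\<forall>k x y. f x (smult Y k y) = smult Z k (f x y))"
  unfolding bilin_def lin_iff by blast

lemma bilin_arith:
  assumes "bilin X Y Z f"
  shows "f (x + x') y = f x y + f x' y" and "f (x - x') y = f x y - f x' y"
    and "f (- x) y = - f x y" and "f 0 y = 0"
    and "f x (y + y') = f x y + f x y'" and "f x (y - y') = f x y - f x y'"
    and "f x (- y) = - f x y" and "f x 0 = 0"
proof -
  have l: "lin X Z (\<lambda>x. f x y)" and r: "lin Y Z (f x)" for x y
    using assms by (auto simp: bilin_def)
  show "f (x + x') y = f x y + f x' y" "f (x - x') y = f x y - f x' y" "f (- x) y = - f x y" "f 0 y = 0"
    using lin_arith[OF l] by auto
  show "f x (y + y') = f x y + f x y'" "f x (y - y') = f x y - f x y'" "f x (- y) = - f x y" "f x 0 = 0"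
    using lin_arith[OF r] by auto
qed

lemma bilin_compose:
  assumes "bilin X Y Z f" and "lin X' X u" and "lin Y' Y v"
  shows "bilin X' Y' Z (\<lambda>x y. f (u x) (v y))"
  using assms by (simp add: bilin_iff lin_iff)

lemma bilin_swap: "bilin X Y Z f \<Longrightarrow> bilin Y X Z (\<lambda>y x. f x y)"
  by (auto simp: bilin_def)

lemma bilin_post: "bilin X Y Z f \<Longrightarrow> lin Z W g \<Longrightarrow> bilin X Y W (\<lambda>x y. g (f x y))"
  by (simp add: bilin_iff lin_iff)

lemma bilin_diff:
  assumes "bilin X Y Z f" and "bilin X Y Z g"
  shows "bilin X Y Z (\<lambda>x y. f x y - g x y)"
  using assms by (auto simp: bilin_iff module.scale_right_diff_distrib module_iff_vector_space)

lemma bilin_cancel: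
  assumes "lin Z W g" and "inj g" and "bilin X Y W (\<lambda>x y. g (f x y))"
  shows "bilin X Y Z f"
  using assms by (simp add: bilin_iff lin_iff inj_eq flip: inj_eq[OF assms(2)])


section \<open>Homomorphisms of anti-dendriform algebras\<close>

lemma anti_dendriformD:
  assumes "anti_dendriform X"
  shows "bilin X X X (ad_succ X)" and "bilin X X X (ad_prec X)"
  using assms by (auto simp: anti_dendriform_def)

lemma ad_homD:
  assumes "f \<in> ad_hom X Y"
  shows "lin X Y f" and "f (x \<succ>\<^bsub>X\<^esub> y) = f x \<succ>\<^bsub>Y\<^esub> f y" and "f (x \<prec>\<^bsub>X\<^esub> y) = f x \<prec>\<^bsub>Y\<^esub> f y"
  using assms by (auto simp: ad_hom_def)

lemma ad_hom_comp: "f \<in> ad_hom X Y \<Longrightarrow> g \<in> ad_hom Y Z \<Longrightarrow> g \<circ> f \<in> ad_hom X Z"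
  by (simp add: ad_hom_def lin_iff)

lemma ad_hom_inv:
  assumes f: "f \<in> ad_hom X Y" and "bij f"
  shows "inv f \<in> ad_hom Y X"
proof -
  have inj: "inj f" and [simp]: "f (inv f y) = y" for y
    using \<open>bij f\<close> by (auto simp: bij_is_inj bij_is_surj surj_f_inv_f)
  have "inv f (x + y) = inv f x + inv f y" "inv f (smult Y k x) = smult X k (inv f x)"
    "inv f (x \<succ>\<^bsub>Y\<^esub> y) = inv f x \<succ>\<^bsub>X\<^esub> inv f y" "inv f (x \<prec>\<^bsub>Y\<^esub> y) = inv f x \<prec>\<^bsub>X\<^esub> inv f y" for x y k
    using f by (simp_all add: ad_hom_def lin_iff flip: inj_eq[OF inj])
  then show ?thesis
    using f by (simp add: ad_hom_def lin_iff)
qed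

text \<open>An injective homomorphism reflects equations, so the bilinearity of the two products and the
  anti-dendriform identities hold in \<open>X\<close> because their images hold in \<open>Y\<close>.\<close>

lemma anti_dendriform_pullback:
  assumes f: "f \<in> ad_hom X Y" and "inj f" and Y: "anti_dendriform Y"
    and fin: "finite_dimensional_vector_space (smult X) Basis"
  shows "anti_dendriform X"
proof -
  have lin: "lin X Y f" and dot: "f (x \<cdot>\<^bsub>X\<^esub> y) = f x \<cdot>\<^bsub>Y\<^esub> f y" for x y
    using f by (auto simp: ad_hom_def ad_dot_def lin_iff)
  note hom = ad_homD(2,3)[OF f] dot lin_arith(3)[OF lin]
  have "bilin X X X (ad_succ X)" "bilin X X X (ad_prec X)"
    using bilin_compose[OF anti_dendriformD(1)[OF Y] lin lin]
      bilin_compose[OF anti_dendriformD(2)[OF Y] lin lin]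
    by (auto intro!: bilin_cancel[OF lin \<open>inj f\<close>] simp: hom)
  moreover have "x \<succ>\<^bsub>X\<^esub> (y \<succ>\<^bsub>X\<^esub> z) = - ((x \<cdot>\<^bsub>X\<^esub> y) \<succ>\<^bsub>X\<^esub> z) \<and>
      - ((x \<cdot>\<^bsub>X\<^esub> y) \<succ>\<^bsub>X\<^esub> z) = - (x \<prec>\<^bsub>X\<^esub> (y \<cdot>\<^bsub>X\<^esub> z)) \<and>
      - (x \<prec>\<^bsub>X\<^esub> (y \<cdot>\<^bsub>X\<^esub> z)) = (x \<prec>\<^bsub>X\<^esub> y) \<prec>\<^bsub>X\<^esub> z \<and>
      (x \<succ>\<^bsub>X\<^esub> y) \<prec>\<^bsub>X\<^esub> z = x \<succ>\<^bsub>X\<^esub> (y \<prec>\<^bsub>X\<^esub> z)" for x y z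
  proof -
    have "f (x \<succ>\<^bsub>X\<^esub> (y \<succ>\<^bsub>X\<^esub> z)) = f (- ((x \<cdot>\<^bsub>X\<^esub> y) \<succ>\<^bsub>X\<^esub> z))"
      "f (- ((x \<cdot>\<^bsub>X\<^esub> y) \<succ>\<^bsub>X\<^esub> z)) = f (- (x \<prec>\<^bsub>X\<^esub> (y \<cdot>\<^bsub>X\<^esub> z)))"
      "f (- (x \<prec>\<^bsub>X\<^esub> (y \<cdot>\<^bsub>X\<^esub> z))) = f ((x \<prec>\<^bsub>X\<^esub> y) \<prec>\<^bsub>X\<^esub> z)"
      "f ((x \<succ>\<^bsub>X\<^esub> y) \<prec>\<^bsub>X\<^esub> z) = f (x \<succ>\<^bsub>X\<^esub> (y \<prec>\<^bsub>X\<^esub> z))"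
      unfolding hom using Y unfolding anti_dendriform_def by blast+
    then show ?thesis by (simp only: inj_eq[OF \<open>inj f\<close>] simp_thms)
  qed
  ultimately show ?thesis
    using fin unfolding anti_dendriform_def by blast
qed


section \<open>Cohomologous cocycles and shears of the sum algebra\<close>

definition shear :: "('a \<Rightarrow> 'b::minus) \<Rightarrow> 'a \<times> 'b \<Rightarrow> 'a \<times> 'b" where
  "shear \<zeta> = (\<lambda>(x, a). (x, a - \<zeta> x))"

lemma bij_shear: "bij (shear (\<zeta> :: 'a \<Rightarrow> 'b::ab_group_add))"
  by (rule bij_betw_byWitness[where f' = "\<lambda>(x, a). (x, a + \<zeta> x)"]) (auto simp: shear_def)

lemma sum_alg_smult:
  assumes "vector_space (smult A)" and "vector_space (smult B)"
  shows "smult (sum_alg A B c) k (x, a) = (smult A k x, smult B k a)"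
    and "vector_space (smult (sum_alg A B c))"
proof -
  interpret vector_space_prod "smult A" "smult B"
    using assms by (simp add: vector_space_prod_def vector_space_pair_def)
  show "smult (sum_alg A B c) k (x, a) = (smult A k x, smult B k a)"
    by (simp add: sum_alg_def scale_prod)
  show "vector_space (smult (sum_alg A B c))"
    by (simp add: sum_alg_def p.vector_space_axioms)
qed

lemma sum_alg_finite_dimensional:
  assumes "anti_dendriform A" and "anti_dendriform B"
  shows "\<exists>Basis. finite_dimensional_vector_space (smult (sum_alg A B c)) Basis"
proof -
  obtain BA BB where "finite_dimensional_vector_space (smult A) BA"
    "finite_dimensional_vector_space (smult B) BB"
    using assms by (auto simp: anti_dendriform_def)
  then interpret finite_dimensional_vector_space_prod "smult A" "smult B" BA BB
    by (simp add: finite_dimensional_vector_space_prod_def vector_space_prod_def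
        vector_space_pair_def finite_dimensional_vector_space_pair_def
        finite_dimensional_vector_space_def)
  show ?thesis
    using p.finite_dimensional_vector_space_axioms by (auto simp: sum_alg_def)
qed

lemma sum_alg_ops:
  "(x, a) \<succ>\<^bsub>sum_alg A B c\<^esub> (y, b) =
    (x \<succ>\<^bsub>A\<^esub> y, omega1 c x y + l_succ c x b + r_succ c y a + a \<succ>\<^bsub>B\<^esub> b)"
  "(x, a) \<prec>\<^bsub>sum_alg A B c\<^esub> (y, b) =
    (x \<prec>\<^bsub>A\<^esub> y, omega2 c x y + l_prec c x b + r_prec c y a + a \<prec>\<^bsub>B\<^esub> b)"
  by (simp_all add: sum_alg_def)

text \<open>
  One of the two products at a time: \<open>?hom\<close> below compares the \<open>B\<close>-components of the shear of a
  product and of the product of the shears. Both sides are sums of terms of bidegree at most one in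
  \<open>(x, a)\<close> and \<open>(y, b)\<close>, so the identity splits into its parts in \<open>(x, b)\<close>, \<open>(a, y)\<close> and
  \<open>(x, y)\<close>, which are the three cohomology equations; the part in \<open>(a, b)\<close> is trivial.
\<close>

lemma shear_product_iff:
  assumes \<zeta>: "lin A B \<zeta>" and M: "bilin A A A M" and m: "bilin B B B m"
    and l: "bilin A B B l" and r: "bilin A B B r" and w: "bilin A A B w"
    and l': "bilin A B B l'" and r': "bilin A B B r'" and w': "bilin A A B w'"
  shows "(\<forall>x y a b. w' x y + l' x b + r' y a + m a b - \<zeta> (M x y) =
        w x y + l x (b - \<zeta> y) + r y (a - \<zeta> x) + m (a - \<zeta> x) (b - \<zeta> y)) \<longleftrightarrow>
    (\<forall>x a. l x a = l' x a + m (\<zeta> x) a) \<and> (\<forall>x a. r x a = r' x a + m a (\<zeta> x)) \<and>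
    (\<forall>x y. w x y + \<zeta> (M x y) = w' x y + l' x (\<zeta> y) + r' y (\<zeta> x) + m (\<zeta> x) (\<zeta> y))"
    (is "?hom \<longleftrightarrow> ?coh")
proof -
  note arith = lin_arith(4)[OF \<zeta>] bilin_arith[OF M] bilin_arith[OF m] bilin_arith[OF l]
    bilin_arith[OF r] bilin_arith[OF w] bilin_arith[OF l'] bilin_arith[OF r'] bilin_arith[OF w']
  show ?thesis
  proof
    assume H: ?hom
    have L: "l x b = l' x b + m (\<zeta> x) b" for x b
      using H[rule_format, of x 0 b 0] by (simp add: arith algebra_simps)
    have R: "r x a = r' x a + m a (\<zeta> x)" for x a
      using H[rule_format, of 0 x 0 a] by (simp add: arith algebra_simps)
    have "w x y + \<zeta> (M x y) = w' x y + l' x (\<zeta> y) + r' y (\<zeta> x) + m (\<zeta> x) (\<zeta> y)" for x y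
      using H[rule_format, of x y 0 0] by (simp add: arith L R algebra_simps)
    with L R show ?coh by blast
  next
    assume C: ?coh
    then have L: "l x b = l' x b + m (\<zeta> x) b" and R: "r x b = r' x b + m b (\<zeta> x)"
      and W: "w x y = w' x y + l' x (\<zeta> y) + r' y (\<zeta> x) + m (\<zeta> x) (\<zeta> y) - \<zeta> (M x y)" for x y b
      by (auto simp: algebra_simps)
    show ?hom by (simp add: W L R arith algebra_simps)
  qed
qed

lemma cohomologous_iff_shear_hom:
  assumes A: "anti_dendriform A" and B: "anti_dendriform B"
    and c: "cocycle A B c" and c': "cocycle A B c'"
  shows "cohomologous A B c c' \<longleftrightarrow>
    (\<exists>\<zeta>. lin A B \<zeta> \<and> shear \<zeta> \<in> ad_hom (sum_alg A B c') (sum_alg A B c))"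
proof -
  have "shear \<zeta> \<in> ad_hom (sum_alg A B c') (sum_alg A B c) \<longleftrightarrow>
      (\<forall>x a. l_prec c x a = l_prec c' x a + \<zeta> x \<prec>\<^bsub>B\<^esub> a) \<and>
      (\<forall>x a. l_succ c x a = l_succ c' x a + \<zeta> x \<succ>\<^bsub>B\<^esub> a) \<and>
      (\<forall>x a. r_prec c x a = r_prec c' x a + a \<prec>\<^bsub>B\<^esub> \<zeta> x) \<and>
      (\<forall>x a. r_succ c x a = r_succ c' x a + a \<succ>\<^bsub>B\<^esub> \<zeta> x) \<and>
      (\<forall>x y. omega1 c x y + \<zeta> (x \<succ>\<^bsub>A\<^esub> y) =
        omega1 c' x y + l_succ c' x (\<zeta> y) + r_succ c' y (\<zeta> x) + \<zeta> x \<succ>\<^bsub>B\<^esub> \<zeta> y) \<and>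
      (\<forall>x y. omega2 c x y + \<zeta> (x \<prec>\<^bsub>A\<^esub> y) =
        omega2 c' x y + l_prec c' x (\<zeta> y) + r_prec c' y (\<zeta> x) + \<zeta> x \<prec>\<^bsub>B\<^esub> \<zeta> y)"
    (is "_ \<longleftrightarrow> ?coh") if \<zeta>: "lin A B \<zeta>" for \<zeta>
  proof -
    have vs: "vector_space (smult A)" "vector_space (smult B)"
      using \<zeta> by (simp_all add: lin_iff)
    have "lin (sum_alg A B c') (sum_alg A B c) (shear \<zeta>)"
      using \<zeta> vs by (auto simp: lin_iff sum_alg_smult shear_def
          module.scale_right_diff_distrib module_iff_vector_space)
    then have "shear \<zeta> \<in> ad_hom (sum_alg A B c') (sum_alg A B c) \<longleftrightarrow>
      (\<forall>x y a b. omega1 c' x y + l_succ c' x b + r_succ c' y a + a \<succ>\<^bsub>B\<^esub> b - \<zeta> (x \<succ>\<^bsub>A\<^esub> y) =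
        omega1 c x y + l_succ c x (b - \<zeta> y) + r_succ c y (a - \<zeta> x) + (a - \<zeta> x) \<succ>\<^bsub>B\<^esub> (b - \<zeta> y)) \<and>
      (\<forall>x y a b. omega2 c' x y + l_prec c' x b + r_prec c' y a + a \<prec>\<^bsub>B\<^esub> b - \<zeta> (x \<prec>\<^bsub>A\<^esub> y) =
        omega2 c x y + l_prec c x (b - \<zeta> y) + r_prec c y (a - \<zeta> x) + (a - \<zeta> x) \<prec>\<^bsub>B\<^esub> (b - \<zeta> y))"
      unfolding ad_hom_def by (simp add: sum_alg_ops shear_def) blast
    also have "\<dots> \<longleftrightarrow> ?coh"
      using c c' unfolding cocycle_def
      by (subst (1 2) shear_product_iff[OF \<zeta>])
        (auto intro: anti_dendriformD[OF A] anti_dendriformD[OF B])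
    finally show ?thesis .
  qed
  then show ?thesis
    using c c' unfolding cohomologous_def by blast
qed


section \<open>Extensions with a section\<close>

locale split_extension =
  fixes A :: "('k::field, 'a::ab_group_add) ad_alg"
    and B :: "('k, 'b::ab_group_add) ad_alg"
    and E :: "('k, 'e::ab_group_add) ad_alg"
    and i :: "'b \<Rightarrow> 'e" and p :: "'e \<Rightarrow> 'a" and s :: "'a \<Rightarrow> 'e"
  assumes ext: "extension A B E i p" and sect: "is_section A E p s"
begin

abbreviation c :: "('a, 'b) cochain" where "c \<equiv> induced_cocycle A E i s"

lemma algebras: "anti_dendriform A" "anti_dendriform B" "anti_dendriform E"
  and hom_i: "i \<in> ad_hom B E" and hom_p: "p \<in> ad_hom E A"
  and inj_i: "inj i" and lin_s: "lin A E s"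
  using ext sect by (auto simp: extension_def is_section_def)

lemmas lin_i = ad_homD(1)[OF hom_i] and lin_p = ad_homD(1)[OF hom_p]
lemmas i_hom = ad_homD(2,3)[OF hom_i] lin_arith[OF lin_i]
  and p_hom = ad_homD(2,3)[OF hom_p] lin_arith[OF lin_p]
  and s_lin = lin_arith[OF lin_s]
  and E_bilin = bilin_arith[OF anti_dendriformD(1)[OF algebras(3)]]
    bilin_arith[OF anti_dendriformD(2)[OF algebras(3)]]

lemma p_s [simp]: "p (s x) = x"
  using sect unfolding is_section_def by (metis comp_apply id_apply)

lemma p_i [simp]: "p (i a) = 0"
  using ext unfolding extension_def by blast

lemma i_inv: "p e = 0 \<Longrightarrow> i (inv i e) = e"
  using ext unfolding extension_def by (metis (mono_tags) f_inv_into_f mem_Collect_eq)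

text \<open>The right-hand sides are killed by \<open>p\<close>, so that \<open>inv i\<close> is applied to elements of the
  range of \<open>i\<close> only.\<close>

lemma i_cocycle:
  "i (l_succ c x a) = s x \<succ>\<^bsub>E\<^esub> i a" "i (r_succ c x a) = i a \<succ>\<^bsub>E\<^esub> s x"
  "i (l_prec c x a) = s x \<prec>\<^bsub>E\<^esub> i a" "i (r_prec c x a) = i a \<prec>\<^bsub>E\<^esub> s x"
  "i (omega1 c x y) = s x \<succ>\<^bsub>E\<^esub> s y - s (x \<succ>\<^bsub>A\<^esub> y)"
  "i (omega2 c x y) = s x \<prec>\<^bsub>E\<^esub> s y - s (x \<prec>\<^bsub>A\<^esub> y)"
  using bilin_arith[OF anti_dendriformD(1)[OF algebras(1)]]
    bilin_arith[OF anti_dendriformD(2)[OF algebras(1)]]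
  by (simp_all add: induced_cocycle_def i_inv p_hom)

text \<open>The splitting of \<open>E\<close> as \<open>A \<oplus> B\<close> that the section determines.\<close>

definition \<Phi> :: "'a \<times> 'b \<Rightarrow> 'e" where
  "\<Phi> = (\<lambda>(x, a). s x + i a)"

lemma p_\<Phi>: "p (\<Phi> z) = fst z"
  by (cases z) (simp add: \<Phi>_def p_hom)

lemma bij_\<Phi>: "bij \<Phi>"
proof (rule bij_betw_byWitness[where f' = "\<lambda>e. (p e, inv i (e - s (p e)))"])
  show "\<forall>z\<in>UNIV. (p (\<Phi> z), inv i (\<Phi> z - s (p (\<Phi> z)))) = z"
    using inj_i by (auto simp: p_\<Phi>) (simp add: \<Phi>_def)
  show "\<forall>e\<in>UNIV. \<Phi> (p e, inv i (e - s (p e))) = e"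
    by (simp add: \<Phi>_def i_inv p_hom)
qed auto

lemma hom_\<Phi>: "\<Phi> \<in> ad_hom (sum_alg A B c) E"
proof -
  have vs: "vector_space (smult A)" "vector_space (smult B)"
    "vector_space (smult E)"
    using lin_s lin_i by (simp_all add: lin_iff)
  have "lin (sum_alg A B c) E \<Phi>"
    using lin_s lin_i vs
    by (auto simp: lin_iff sum_alg_smult \<Phi>_def algebra_simps
        module.scale_right_distrib module_iff_vector_space)
  then show ?thesis
    by (auto simp: ad_hom_def sum_alg_ops \<Phi>_def i_hom i_cocycle E_bilin algebra_simps)
qed

text \<open>The components are bilinear because the products of \<open>E\<close> are, and \<open>i\<close> is an injective linear
  map; the sum algebra is anti-dendriform because it is isomorphic to \<open>E\<close>.\<close>

lemma cocycle_induced: "cocycle A B c"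
proof -
  note E = anti_dendriformD[OF algebras(3)]
  note A = anti_dendriformD[OF algebras(1)]
  note [intro!] = bilin_cancel[OF lin_i inj_i]
  have "bilin A B B (l_succ c)" "bilin A B B (r_succ c)"
    "bilin A B B (l_prec c)" "bilin A B B (r_prec c)"
    using bilin_compose[OF E(1) lin_s lin_i] bilin_compose[OF bilin_swap[OF E(1)] lin_s lin_i]
      bilin_compose[OF E(2) lin_s lin_i] bilin_compose[OF bilin_swap[OF E(2)] lin_s lin_i]
    by (auto simp: i_cocycle)
  moreover have "bilin A A B (omega1 c)" "bilin A A B (omega2 c)"
    using bilin_diff[OF bilin_compose[OF E(1) lin_s lin_s] bilin_post[OF A(1) lin_s]]
      bilin_diff[OF bilin_compose[OF E(2) lin_s lin_s] bilin_post[OF A(2) lin_s]]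
    by (auto simp: i_cocycle)
  moreover obtain Basis where "finite_dimensional_vector_space (smult (sum_alg A B c)) Basis"
    using sum_alg_finite_dimensional[OF algebras(1,2)] by blast
  then have "anti_dendriform (sum_alg A B c)"
    using anti_dendriform_pullback[OF hom_\<Phi> bij_is_inj[OF bij_\<Phi>] algebras(3)] by blast
  ultimately show ?thesis by (simp add: cocycle_def)
qed

end

section \<open>Equivalent extensions have cohomologous cocycles, and conversely\<close>

text \<open>
  A shear that is a homomorphism gives the equivalence \<open>\<Phi> \<circ> shear \<zeta> \<circ> inv \<Phi>'\<close>. Conversely, an
  equivalence \<open>\<gamma>\<close> carries \<open>s'\<close> to a second section of \<open>p\<close>, and \<open>\<zeta>\<close> is the difference of
  \<open>s\<close> and \<open>\<gamma> \<circ> s'\<close>, which takes values in the kernel \<open>i(B)\<close> of \<open>p\<close>.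
\<close>

theorem cohomologous_iff_equivalent_extensions:
  assumes "split_extension A B E i p s" and "split_extension A B E' i' p' s'"
  shows "cohomologous A B (induced_cocycle A E i s) (induced_cocycle A E' i' s') \<longleftrightarrow>
    (\<exists>\<gamma> \<in> ad_hom E' E. bij \<gamma> \<and> \<gamma> \<circ> i' = i \<and> p \<circ> \<gamma> = p')"
proof -
  interpret split_extension A B E i p s by fact
  interpret E': split_extension A B E' i' p' s' by fact
  have "(\<exists>\<zeta>. lin A B \<zeta> \<and> shear \<zeta> \<in> ad_hom (sum_alg A B E'.c) (sum_alg A B c)) \<longleftrightarrow>
    (\<exists>\<gamma> \<in> ad_hom E' E. bij \<gamma> \<and> \<gamma> \<circ> i' = i \<and> p \<circ> \<gamma> = p')"
  proof
    assume "\<exists>\<zeta>. lin A B \<zeta> \<and> shear \<zeta> \<in> ad_hom (sum_alg A B E'.c) (sum_alg A B c)"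
    then obtain \<zeta> where \<zeta>: "lin A B \<zeta>"
      and hom: "shear \<zeta> \<in> ad_hom (sum_alg A B E'.c) (sum_alg A B c)" by blast
    define \<gamma> where "\<gamma> = \<Phi> \<circ> shear \<zeta> \<circ> inv E'.\<Phi>"
    have \<gamma>_\<Phi>: "\<gamma> (E'.\<Phi> z) = \<Phi> (shear \<zeta> z)" for z
      using E'.bij_\<Phi> by (simp add: \<gamma>_def bij_is_inj)
    have "\<gamma> \<in> ad_hom E' E"
      unfolding \<gamma>_def by (intro ad_hom_comp[OF ad_hom_inv[OF E'.hom_\<Phi> E'.bij_\<Phi>]]
          ad_hom_comp[OF hom hom_\<Phi>])
    moreover have "bij \<gamma>"
      unfolding \<gamma>_def by (intro bij_comp bij_shear bij_\<Phi> bij_imp_bij_inv E'.bij_\<Phi>)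
    moreover have "\<gamma> \<circ> i' = i"
    proof
      fix a
      show "(\<gamma> \<circ> i') a = i a"
        using \<gamma>_\<Phi>[of "(0, a)"] lin_arith(4)[OF \<zeta>]
        by (simp add: \<Phi>_def E'.\<Phi>_def shear_def s_lin E'.s_lin)
    qed
    moreover have "p \<circ> \<gamma> = p'"
    proof
      fix e
      obtain z where "e = E'.\<Phi> z"
        using E'.bij_\<Phi> by (metis bij_pointE)
      then show "(p \<circ> \<gamma>) e = p' e"
        by (cases z) (simp add: \<gamma>_\<Phi> p_\<Phi> E'.p_\<Phi> shear_def)
    qed
    ultimately show "\<exists>\<gamma> \<in> ad_hom E' E. bij \<gamma> \<and> \<gamma> \<circ> i' = i \<and> p \<circ> \<gamma> = p'" by blast
  next
    assume "\<exists>\<gamma> \<in> ad_hom E' E. bij \<gamma> \<and> \<gamma> \<circ> i' = i \<and> p \<circ> \<gamma> = p'"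
    then obtain \<gamma> where \<gamma>: "\<gamma> \<in> ad_hom E' E" and "\<gamma> \<circ> i' = i" and "p \<circ> \<gamma> = p'" by blast
    then have [simp]: "\<gamma> (i' a) = i a" "p (\<gamma> e) = p' e" for a e
      by (auto simp: fun_eq_iff)
    define \<zeta> where "\<zeta> x = inv i (s x - \<gamma> (s' x))" for x
    have i_\<zeta>: "i (\<zeta> x) = s x - \<gamma> (s' x)" for x
      by (simp add: \<zeta>_def i_inv p_hom)
    have lin_\<gamma>s': "lin A E (\<gamma> \<circ> s')"
      using E'.lin_s ad_homD(1)[OF \<gamma>] by (simp add: lin_iff)
    have "\<zeta> (x + y) = \<zeta> x + \<zeta> y" "\<zeta> (smult A k x) = smult B k (\<zeta> x)" for x y k
      using lin_i lin_s lin_\<gamma>s'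
      by (simp_all add: i_\<zeta> lin_iff algebra_simps module.scale_right_diff_distrib
          module_iff_vector_space flip: inj_eq[OF inj_i])
    then have \<zeta>: "lin A B \<zeta>"
      using lin_i lin_s by (simp add: lin_iff)
    have "inv \<Phi> \<circ> \<gamma> \<circ> E'.\<Phi> = shear \<zeta>"
    proof
      fix z
      have "\<gamma> (E'.\<Phi> z) = \<Phi> (shear \<zeta> z)"
        by (cases z) (simp add: \<Phi>_def E'.\<Phi>_def shear_def i_hom i_\<zeta> lin_arith[OF ad_homD(1)[OF \<gamma>]])
      then show "(inv \<Phi> \<circ> \<gamma> \<circ> E'.\<Phi>) z = shear \<zeta> z"
        using bij_\<Phi> by (simp add: bij_is_inj)
    qed
    then have "shear \<zeta> \<in> ad_hom (sum_alg A B E'.c) (sum_alg A B c)"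
      using ad_hom_comp[OF E'.hom_\<Phi> ad_hom_comp[OF \<gamma> ad_hom_inv[OF hom_\<Phi> bij_\<Phi>]]]
      by (simp add: comp_assoc)
    with \<zeta> show "\<exists>\<zeta>. lin A B \<zeta> \<and> shear \<zeta> \<in> ad_hom (sum_alg A B E'.c) (sum_alg A B c)" by blast
  qed
  then show ?thesis
    using cohomologous_iff_shear_hom[OF algebras(1,2) cocycle_induced E'.cocycle_induced] by simp
qed

section \<open>Inducibility\<close>

lemma split_extension_twist:
  assumes "split_extension A B E i p s" and \<alpha>: "\<alpha> \<in> ad_Aut A" and \<beta>: "\<beta> \<in> ad_Aut B"
  shows "split_extension A B E (i \<circ> inv \<beta>) (\<alpha> \<circ> p) (s \<circ> inv \<alpha>)"
proof -
  interpret split_extension A B E i p s by fact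
  have hom: "\<alpha> \<in> ad_hom A A" "\<beta> \<in> ad_hom B B" and bij: "bij \<alpha>" "bij \<beta>"
    using \<alpha> \<beta> by (auto simp: ad_Aut_def)
  have "range (i \<circ> inv \<beta>) = range i"
    using bij(2) by (metis bij_imp_bij_inv bij_is_surj image_comp)
  moreover have "\<alpha> x = 0 \<longleftrightarrow> x = 0" for x
    using bij(1) lin_arith(4)[OF ad_homD(1)[OF hom(1)]] by (metis bij_is_inj injD)
  moreover have "inj (i \<circ> inv \<beta>)" "surj (\<alpha> \<circ> p)"
    using ext bij inj_compose[OF inj_i bij_is_inj[OF bij_imp_bij_inv[OF bij(2)]]]
      comp_surj[OF _ bij_is_surj[OF bij(1)], of p]
    by (simp_all add: extension_def)
  ultimately have "extension A B E (i \<circ> inv \<beta>) (\<alpha> \<circ> p)"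
    using ext ad_hom_comp[OF ad_hom_inv[OF hom(2) bij(2)] hom_i] ad_hom_comp[OF hom_p hom(1)]
    by (simp add: extension_def)
  moreover have "is_section A E (\<alpha> \<circ> p) (s \<circ> inv \<alpha>)"
    using lin_s ad_homD(1)[OF ad_hom_inv[OF hom(1) bij(1)]] bij(1)
    by (auto simp: is_section_def lin_iff bij_is_surj surj_f_inv_f)
  ultimately show ?thesis by unfold_locales
qed

text \<open>Both sides are compared after applying the injection \<open>i \<circ> inv \<beta>\<close>, which turns each component
  into an expression in \<open>E\<close>. For the two \<open>\<omega>\<close> components the expressions agree because \<open>inv \<alpha>\<close>
  preserves the products of \<open>A\<close>.\<close>

lemma twist_induced_cocycle:
  assumes "split_extension A B E i p s" and \<alpha>: "\<alpha> \<in> ad_Aut A" and \<beta>: "\<beta> \<in> ad_Aut B"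
  shows "twist \<alpha> \<beta> (induced_cocycle A E i s) =
    induced_cocycle A E (i \<circ> inv \<beta>) (s \<circ> inv \<alpha>)"
proof -
  interpret split_extension A B E i p s by fact
  interpret T: split_extension A B E "i \<circ> inv \<beta>" "\<alpha> \<circ> p" "s \<circ> inv \<alpha>"
    using assms by (rule split_extension_twist)
  have hom: "inv \<alpha> \<in> ad_hom A A" and [simp]: "inv \<beta> (\<beta> a) = a" for a
    using \<alpha> \<beta> by (auto simp: ad_Aut_def ad_hom_inv bij_is_inj)
  note T_unfolded = T.i_cocycle[unfolded comp_def ad_homD(2,3)[OF hom]] T.inj_i[unfolded comp_def]
  show ?thesis
    unfolding comp_def
    by (rule cochain.equality)
      (simp_all add: fun_eq_iff twist_def i_cocycle T_unfolded(1-6) flip: inj_eq[OF T_unfolded(7)])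
qed

text \<open>Composing with \<open>\<beta>\<close> or its inverse turns one compatibility of \<open>\<gamma>\<close> with \<open>i\<close> into the other;
  moreover \<open>\<gamma>(i(B)) = i(\<beta>(B)) = i(B)\<close>.\<close>

lemma inducible_iff_equivalent:
  assumes \<beta>: "bij \<beta>"
  shows "inducible E i p \<alpha> \<beta> \<longleftrightarrow>
    (\<exists>\<gamma> \<in> ad_hom E E. bij \<gamma> \<and> \<gamma> \<circ> (i \<circ> inv \<beta>) = i \<and> p \<circ> \<gamma> = \<alpha> \<circ> p)"
proof -
  have inverse: "\<beta> \<circ> inv \<beta> = id" "inv \<beta> \<circ> \<beta> = id"
    using \<beta> by (simp_all add: bij_is_inj bij_is_surj flip: surj_iff)
  have "\<gamma> \<circ> (i \<circ> inv \<beta>) = i \<longleftrightarrow> i \<circ> \<beta> = \<gamma> \<circ> i" for \<gamma>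
    using inverse by (metis comp_assoc comp_id)
  moreover have "\<gamma> ` range i = range i" if "i \<circ> \<beta> = \<gamma> \<circ> i" for \<gamma>
    using that \<beta> by (metis bij_is_surj image_comp)
  ultimately show ?thesis
    unfolding inducible_def ad_Aut_def by blast
qed

theorem theorem4p15:
  fixes A :: "('k::field, 'a::ab_group_add) ad_alg"
    and B :: "('k, 'b::ab_group_add) ad_alg"
    and E :: "('k, 'e::ab_group_add) ad_alg"
    and i :: "'b \<Rightarrow> 'e" and p :: "'e \<Rightarrow> 'a" and s :: "'a \<Rightarrow> 'e"
    and \<alpha> :: "'a \<Rightarrow> 'a" and \<beta> :: "'b \<Rightarrow> 'b"
  assumes "extension A B E i p"
    and "is_section A E p s"
    and "\<alpha> \<in> ad_Aut A" and "\<beta> \<in> ad_Aut B"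
  shows "inducible E i p \<alpha> \<beta> \<longleftrightarrow>
    cohomologous A B (induced_cocycle A E i s) (twist \<alpha> \<beta> (induced_cocycle A E i s))"
proof -
  have E: "split_extension A B E i p s"
    using assms(1,2) by unfold_locales
  have "bij \<beta>"
    using assms(4) by (simp add: ad_Aut_def)
  then show ?thesis
    unfolding twist_induced_cocycle[OF E assms(3,4)]
      cohomologous_iff_equivalent_extensions[OF E split_extension_twist[OF E assms(3,4)]]
    by (rule inducible_iff_equivalent)
qed

end
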